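(* Let $A=M_n(\mathbb{C})$, let $\psi$ be a state on $A$, let $a_1,a_2\in A_{sa}$, let $\Delta_1,\Delta_2\subseteq\mathbb{R}$ be open, and let $C\in\mathcal{C}$. If $\underline{[a\in\Delta]}$ is defined using $\delta^{o}(\chi_{\Delta}(a))$, then the following two conditions are equivalent in the contravariant model: 1. $C\Vdash\underline{\mu}(\underline{[a_{1}\in\Delta_{1}]}\wedge\underline{[a_{2}\in\Delta_{2}]})=\underline{1}$; 2. If $p\in\mathrm{Proj}(C)$ satisfies $p\geq\chi_{\Delta_{1}}(a_{1})$ or $p\geq\chi_{\Delta_{2}}(a_{2})$, then $\psi(p)=1$.
   Context: Contravariant model: $\mathcal{C}$ is the poset (under inclusion) of abelian von Neumann subalgebras of $A$ (containing the unit of $A$); the topos is $[\mathcal{C}^{op},\mathbf{Set}]$. $\Sigma_C$ is the Gelfand spectrum of $C$. $\Sigma_{\downarrow}=\coprod_C\Sigma_C$ with $U$ open iff (1) $(C,\lambda)\in U$ and $D\subseteq C$ imply $(D,\lambda|_D)\in U$, and (2) $U_C:=U\cap\Sigma_C$ is open in $\Sigma_C$ for all $C$. $\mathcal{O}\Sigma_{\downarrow}$ is a complete Heyting algebra under inclusion, and the connective $\wedge$ is taken in it. For a projection $p\in A$, $\delta^o(p)_C=\bigwedge\{q\in\mathrm{Proj}(C)\mid q\geq p\}$. The elementary proposition $\underline{[a\in\Delta]}$ is (externally) the open $[a\in\Delta]=\{(C,\lambda)\in\Sigma_{\downarrow}\mid\lambda(\delta^o(\chi_\Delta(a))_C)=1\}$,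 where $\chi_\Delta(a)$ is the spectral projection. $\underline{\mu}$ is the internal probability valuation associated to $\psi$: externally $\mu(U)(C)=\mu^{C}(U_C)$ for $U\in\mathcal{O}\Sigma_{\downarrow}$, with $\mu^C:\mathcal{O}\Sigma_C\to[0,1]$ the probability valuation corresponding to $\psi|_C$ by Riesz–Markov (so if $U_C$ is the clopen set corresponding to the projection $p_C\in C$, then $\mu(U)(C)=\psi(p_C)$). By presheaf semantics, $C\Vdash\underline{\mu}(\underline{U})=\underline{1}$ means $\mu(U)(D)=1$ for all $D\subseteq C$. *)

theory Defs
  imports "HOL-Probability.Probability_Measure" "HOL-Analysis.Analysis" "HOL-Algebra.Lattice"
begin

section \<open>The matrix algebra\<close>

text \<open>The algebra is \<open>complex^'n^'n\<close> with product \<open>**\<close> and unit \<open>mat 1\<close>. The matrix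
  \<open>mat c\<close> is \<open>c\<close> times the unit, so \<open>mat c ** x\<close> is the scalar multiple of \<open>x\<close> by \<open>c\<close>.\<close>

type_synonym 'n cmat = "complex^'n^'n"

definition star :: "'n::finite cmat \<Rightarrow> 'n cmat" where
  "star x = (\<chi> i j. cnj (x $ j $ i))"

definition selfadjoint :: "'n::finite cmat \<Rightarrow> bool" where
  "selfadjoint x \<longleftrightarrow> star x = x"

definition positive :: "'n::finite cmat \<Rightarrow> bool" where
  "positive x \<longleftrightarrow> (\<exists>y. x = star y ** y)"

definition op_le :: "'n::finite cmat \<Rightarrow> 'n cmat \<Rightarrow> bool" where
  "op_le x y \<longleftrightarrow> positive (y - x)"

definition is_projection :: "'n::finite cmat \<Rightarrow> bool" where
  "is_projection p \<longleftrightarrow> selfadjoint p \<and> p ** p = p"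

definition is_state :: "('n::finite cmat \<Rightarrow> complex) \<Rightarrow> bool" where
  "is_state \<psi> \<longleftrightarrow>
     (\<forall>x y. \<psi> (x + y) = \<psi> x + \<psi> y) \<and>
     (\<forall>c x. \<psi> (mat c ** x) = c * \<psi> x) \<and>
     (\<forall>x. positive x \<longrightarrow> \<psi> x \<in> \<real>\<^sub>\<ge>\<^sub>0) \<and>
     \<psi> (mat 1) = 1"

definition eigenspace :: "'n::finite cmat \<Rightarrow> real \<Rightarrow> (complex^'n) set" where
  "eigenspace a r = {v. a *v v = complex_of_real r *s v}"

definition eigenprojection :: "'n::finite cmat \<Rightarrow> real \<Rightarrow> 'n cmat" where
  "eigenprojection a r = (THE p. is_projection p \<and> range ((*v) p) = eigenspace a r)"

text \<open>\<open>\<chi>\<^sub>\<Delta>(a)\<close> for selfadjoint \<open>a\<close>, whose spectrum is a finite set of real eigenvalues.\<close>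

definition spectral_projection :: "real set \<Rightarrow> 'n::finite cmat \<Rightarrow> 'n cmat" where
  "spectral_projection \<Delta> a =
     (\<Sum>r | r \<in> \<Delta> \<and> eigenspace a r \<noteq> {0}. eigenprojection a r)"


section \<open>Contexts\<close>

definition commutant :: "'n::finite cmat set \<Rightarrow> 'n cmat set" where
  "commutant S = {x. \<forall>y\<in>S. x ** y = y ** x}"

definition von_neumann_subalgebra :: "'n::finite cmat set \<Rightarrow> bool" where
  "von_neumann_subalgebra C \<longleftrightarrow>
     (\<forall>c. mat c \<in> C) \<and>
     (\<forall>x\<in>C. \<forall>y\<in>C. x + y \<in> C \<and> x ** y \<in> C) \<and>
     (\<forall>x\<in>C. star x \<in> C) \<and>
     commutant (commutant C) = C"

definition contexts :: "'n::finite cmat set set" where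
  "contexts = {C. von_neumann_subalgebra C \<and> (\<forall>x\<in>C. \<forall>y\<in>C. x ** y = y ** x)}"

definition Proj :: "'n::finite cmat set \<Rightarrow> 'n cmat set" where
  "Proj C = {p \<in> C. is_projection p}"

definition proj_lattice :: "'n::finite cmat set \<Rightarrow> 'n cmat gorder" where
  "proj_lattice C = \<lparr>carrier = Proj C, eq = (=), le = op_le\<rparr>"

text \<open>Outer daseinisation \<open>\<delta>\<^sup>o(p)\<^sub>C\<close>.\<close>

definition outer_das :: "'n::finite cmat \<Rightarrow> 'n cmat set \<Rightarrow> 'n cmat" where
  "outer_das p C = \<Sqinter>\<^bsub>proj_lattice C\<^esub> {q \<in> Proj C. op_le p q}"


section \<open>The spectral presheaf\<close>

text \<open>Characters of \<open>C\<close> are the unital algebra homomorphisms from \<open>C\<close> to the complex numbers,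
  represented by functions that are \<open>undefined\<close> outside \<open>C\<close>; the restriction of \<open>l\<close> to a
  smaller context \<open>D\<close> is therefore \<open>restrict l D\<close>.\<close>

definition gelfand :: "'n::finite cmat set \<Rightarrow> ('n cmat \<Rightarrow> complex) set" where
  "gelfand C = {l \<in> extensional C.
     (\<forall>x\<in>C. \<forall>y\<in>C. l (x + y) = l x + l y \<and> l (x ** y) = l x * l y) \<and>
     (\<forall>c. l (mat c) = c)}"

text \<open>The weak-* topology, i.e. pointwise convergence on \<open>C\<close>.\<close>

definition gelfand_topology :: "'n::finite cmat set \<Rightarrow> ('n cmat \<Rightarrow> complex) topology" where
  "gelfand_topology C = subtopology (product_topology (\<lambda>_. euclidean) C) (gelfand C)"

lemma topspace_gelfand_topology: "topspace (gelfand_topology C) = gelfand C"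
  by (simp add: gelfand_topology_def topspace_subtopology) (auto simp: gelfand_def PiE_def)

text \<open>The fibre \<open>U\<^sub>C\<close> of a set \<open>U\<close> of pairs is the relational image \<open>U `` {C}\<close>.\<close>

definition Sigma_open ::
    "('n::finite cmat set \<times> ('n cmat \<Rightarrow> complex)) set \<Rightarrow> bool" where
  "Sigma_open U \<longleftrightarrow>
     U \<subseteq> Sigma contexts gelfand \<and>
     (\<forall>C l. (C, l) \<in> U \<longrightarrow> (\<forall>D\<in>contexts. D \<subseteq> C \<longrightarrow> (D, restrict l D) \<in> U)) \<and>
     (\<forall>C\<in>contexts. openin (gelfand_topology C) (U `` {C}))"

lemma istopology_Sigma_open: "istopology Sigma_open"
  unfolding istopology_def
proof (intro conjI allI impI)
  fix S T :: "('n::finite cmat set \<times> ('n cmat \<Rightarrow> complex)) set"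
  assume S: "Sigma_open S" and T: "Sigma_open T"
  have "S \<inter> T \<subseteq> Sigma contexts gelfand"
    using S unfolding Sigma_open_def by blast
  moreover have "(D, restrict l D) \<in> S \<inter> T"
    if "(C, l) \<in> S \<inter> T" "D \<in> contexts" "D \<subseteq> C" for C l D
    using S T that unfolding Sigma_open_def by blast
  moreover have "openin (gelfand_topology C) ((S \<inter> T) `` {C})" if "C \<in> contexts" for C
  proof -
    have "(S \<inter> T) `` {C} = S `` {C} \<inter> T `` {C}"
      by blast
    moreover have "openin (gelfand_topology C) (S `` {C} \<inter> T `` {C})"
      using S T that unfolding Sigma_open_def by (intro openin_Int) blast+
    ultimately show ?thesis
      by (simp only:)
  qed
  ultimately show "Sigma_open (S \<inter> T)"
    unfolding Sigma_open_def by blast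
next
  fix K :: "('n::finite cmat set \<times> ('n cmat \<Rightarrow> complex)) set set"
  assume K: "\<forall>U\<in>K. Sigma_open U"
  have "\<Union>K \<subseteq> Sigma contexts gelfand"
  proof (rule Union_least)
    fix U assume "U \<in> K"
    with K have "Sigma_open U" by (rule bspec)
    then show "U \<subseteq> Sigma contexts gelfand"
      unfolding Sigma_open_def by (rule conjunct1)
  qed
  moreover have "(D, restrict l D) \<in> \<Union>K"
    if "(C, l) \<in> \<Union>K" "D \<in> contexts" "D \<subseteq> C" for C l D
  proof -
    from that(1) obtain U where U: "U \<in> K" "(C, l) \<in> U" ..
    from K U(1) have "Sigma_open U" by (rule bspec)
    then have "(D, restrict l D) \<in> U"
      using U(2) that(2,3) unfolding Sigma_open_def by blast
    with U(1) show ?thesis by (rule UnionI)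
  qed
  moreover have "openin (gelfand_topology C) ((\<Union>K) `` {C})" if "C \<in> contexts" for C
  proof -
    have "(\<Union>K) `` {C} = (\<Union>U\<in>K. U `` {C})"
      by blast
    moreover have "openin (gelfand_topology C) (\<Union>U\<in>K. U `` {C})"
    proof (rule openin_Union)
      fix V assume "V \<in> (\<lambda>U. U `` {C}) ` K"
      then obtain U where V: "V = U `` {C}" and U: "U \<in> K" ..
      from K U have "Sigma_open U" by (rule bspec)
      then show "openin (gelfand_topology C) V"
        using that unfolding Sigma_open_def V by blast
    qed
    ultimately show ?thesis
      by (simp only:)
  qed
  ultimately show "Sigma_open (\<Union>K)"
    unfolding Sigma_open_def[of "\<Union>K"] by (intro conjI allI ballI impI)
qed

definition Sigma_down :: "('n::finite cmat set \<times> ('n cmat \<Rightarrow> complex)) topology" where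
  "Sigma_down = topology Sigma_open"

lemma openin_Sigma_down: "openin Sigma_down U \<longleftrightarrow> Sigma_open U"
  by (simp add: Sigma_down_def istopology_Sigma_open)

text \<open>The frame \<open>O\<Sigma>\<^sub>\<down>\<close>, ordered by inclusion.\<close>

definition Sigma_frame ::
    "('n::finite cmat set \<times> ('n cmat \<Rightarrow> complex)) set gorder" where
  "Sigma_frame = \<lparr>carrier = {U. openin Sigma_down U}, eq = (=), le = (\<subseteq>)\<rparr>"

text \<open>The elementary proposition \<open>[a \<in> \<Delta>]\<close>.\<close>

definition elem_prop ::
    "'n::finite cmat \<Rightarrow> real set \<Rightarrow> ('n cmat set \<times> ('n cmat \<Rightarrow> complex)) set" where
  "elem_prop a \<Delta> =
     {(C, l). C \<in> contexts \<and> l \<in> gelfand C \<and> l (outer_das (spectral_projection \<Delta> a) C) = 1}"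


section \<open>The probability valuation of a state\<close>

text \<open>The Riesz--Markov measure: the unique regular Borel probability measure on the Gelfand
  spectrum that represents the restriction of \<open>\<psi>\<close> to \<open>C\<close>. As the measure is finite and
  the spectrum compact Hausdorff, outer regularity is the full regularity requirement.\<close>

definition represents ::
    "('n::finite cmat \<Rightarrow> complex) \<Rightarrow> 'n cmat set \<Rightarrow> ('n cmat \<Rightarrow> complex) measure \<Rightarrow> bool" where
  "represents \<psi> C M \<longleftrightarrow>
     prob_space M \<and>
     space M = gelfand C \<and>
     sets M = sigma_sets (gelfand C) {U. openin (gelfand_topology C) U} \<and>
     (\<forall>B\<in>sets M. measure M B =
        (INF U\<in>{U. openin (gelfand_topology C) U \<and> B \<subseteq> U}. measure M U)) \<and>
     (\<forall>x\<in>C. integrable M (\<lambda>l. l x) \<and> integral\<^sup>L M (\<lambda>l. l x) = \<psi> x)"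

definition riesz_markov ::
    "('n::finite cmat \<Rightarrow> complex) \<Rightarrow> 'n cmat set \<Rightarrow> ('n cmat \<Rightarrow> complex) measure" where
  "riesz_markov \<psi> C = (THE M. represents \<psi> C M)"

text \<open>\<open>state_val \<psi> U C\<close> is \<open>\<mu>(U)(C)\<close>.\<close>

definition state_val ::
    "('n::finite cmat \<Rightarrow> complex) \<Rightarrow> ('n cmat set \<times> ('n cmat \<Rightarrow> complex)) set \<Rightarrow>
     'n cmat set \<Rightarrow> real" where
  "state_val \<psi> U C = measure (riesz_markov \<psi> C) (U `` {C})"

text \<open>The presheaf semantics of \<open>C \<tturnstile> \<mu>(U) = 1\<close>.\<close>

definition forces_val_one ::
    "'n::finite cmat set \<Rightarrow> ('n cmat \<Rightarrow> complex) \<Rightarrow>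
     ('n cmat set \<times> ('n cmat \<Rightarrow> complex)) set \<Rightarrow> bool" where
  "forces_val_one C \<psi> U \<longleftrightarrow> (\<forall>D\<in>contexts. D \<subseteq> C \<longrightarrow> state_val \<psi> U D = 1)"

end

theory Submission
  imports Defs "HOL-Computational_Algebra.Fundamental_Theorem_Algebra"
begin

text \<open>A context \<open>D\<close> of matrices is spanned by the orthogonal projections \<open>q\<^sub>l\<close> onto its joint
  eigenspaces, indexed by the characters \<open>l\<close> of \<open>D\<close>. Hence the Gelfand spectrum is finite and
  discrete, the Riesz--Markov measure gives mass \<open>\<psi>(q\<^sub>l)\<close> to \<open>l\<close>, and the clopen set
  \<open>{l. l(p) = 1}\<close> of a projection \<open>p \<in> D\<close> has measure \<open>\<psi>(p)\<close>. The fibre over \<open>D\<close> of the meet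
  is the clopen set of \<open>d\<^sub>1 d\<^sub>2\<close>, where \<open>d\<^sub>i = \<delta>\<^sup>o(\<chi>(a\<^sub>i))\<^sub>D\<close>, and \<open>\<psi>(d\<^sub>1 d\<^sub>2) = 1\<close> iff
  \<open>\<psi>(d\<^sub>1) = \<psi>(d\<^sub>2) = 1\<close>, as \<open>1 - d\<^sub>1 d\<^sub>2 = (1 - d\<^sub>1) + d\<^sub>1 (1 - d\<^sub>2)\<close>. What remains is that
  \<open>d\<^sub>i\<close> is the least projection of \<open>D\<close> above \<open>\<chi>(a\<^sub>i)\<close>.\<close>

section \<open>Matrices and projections\<close>

lemma matrix_diff_ldistrib: "A ** (B - C) = A ** B - A ** (C :: 'a::comm_ring_1^'n^'m)"
  by (vector matrix_matrix_mult_def sum_subtractf[symmetric] algebra_simps)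

lemma matrix_diff_rdistrib: "(A - B) ** C = A ** C - B ** (C :: 'a::comm_ring_1^'n^'m)"
  by (vector matrix_matrix_mult_def sum_subtractf[symmetric] algebra_simps)

lemma matrix_add_rdistrib: "(A + B) ** C = A ** C + B ** (C :: 'a::comm_ring_1^'n^'m)"
  by (vector matrix_matrix_mult_def sum.distrib[symmetric] algebra_simps)

lemma matrix_sum_ldistrib:
  "A ** (\<Sum>i\<in>I. f i) = (\<Sum>i\<in>I. A ** (f i :: 'a::comm_ring_1^'n^'m))"
  by (induction I rule: infinite_finite_induct) (simp_all add: matrix_add_ldistrib)

lemma matrix_sum_rdistrib:
  "(\<Sum>i\<in>I. f i) ** A = (\<Sum>i\<in>I. f i ** (A :: 'a::comm_ring_1^'n^'m))"
  by (induction I rule: infinite_finite_induct) (simp_all add: matrix_add_rdistrib)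

lemma mat_mult_component: "(mat c ** x) $ i $ j = c * (x :: 'a::comm_ring_1^'n^'m) $ i $ j"
proof -
  have "(\<Sum>k\<in>UNIV. (if i = k then c else 0) * x $ k $ j) = (\<Sum>k\<in>UNIV. if k = i then c * x $ k $ j else 0)"
    by (rule sum.cong) auto
  then show ?thesis
    by (simp add: matrix_matrix_mult_def mat_def)
qed

lemma mult_mat_component: "(x ** mat c) $ i $ j = c * (x :: 'a::comm_ring_1^'n^'m) $ i $ j"
proof -
  have "(\<Sum>k\<in>UNIV. x $ i $ k * (if k = j then c else 0)) = (\<Sum>k\<in>UNIV. if k = j then c * x $ i $ k else 0)"
    by (rule sum.cong) auto
  then show ?thesis
    by (simp add: matrix_matrix_mult_def mat_def)
qed

lemma mat_mult_commute: "x ** mat c = mat c ** (x :: 'a::comm_ring_1^'n^'m)"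
  by (simp add: vec_eq_iff mat_mult_component mult_mat_component)

lemma mat_mult_left_commute: "x ** (mat c ** y) = mat c ** (x ** (y :: 'a::comm_ring_1^'n^'n))"
  by (simp only: matrix_mul_assoc mat_mult_commute[of x])

lemma mat_mult_vector: "mat c *v v = c *s (v :: 'a::comm_ring_1^'n)"
proof -
  have "(\<Sum>j\<in>UNIV. (if i = j then c else 0) * v $ j) = (\<Sum>j\<in>UNIV. if j = i then c * v $ j else 0)" for i
    by (rule sum.cong) auto
  then show ?thesis
    by (simp add: vec_eq_iff matrix_vector_mult_def mat_def)
qed

text \<open>A nonzero entry of \<open>x\<close> reveals the scalar. Later this compares two
  eigenvalues that act on the same nonzero product of projections.\<close>

lemma mat_mult_left_cancel:
  assumes "mat a ** x = mat b ** x" "x \<noteq> (0 :: 'a::field^'n^'m)"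
  shows "a = b"
proof -
  obtain i j where "x $ i $ j \<noteq> 0"
    using assms(2) by (auto simp: vec_eq_iff)
  moreover have "a * x $ i $ j = b * x $ i $ j"
    using assms(1) by (metis mat_mult_component)
  ultimately show ?thesis by simp
qed

lemma scaleR_eq_mat_mult: "r *\<^sub>R x = mat (complex_of_real r) ** (x :: 'n::finite cmat)"
  by (simp add: vec_eq_iff mat_mult_component) (simp add: scaleR_conv_of_real)

section \<open>The adjoint and the trace inner product\<close>

lemma star_star [simp]: "star (star x) = x"
  by (simp add: star_def vec_eq_iff)

lemma star_mult: "star (x ** y) = star y ** star x"
  by (simp add: star_def vec_eq_iff matrix_matrix_mult_def mult.commute)

lemma star_add: "star (x + y) = star x + star y"
  by (simp add: star_def vec_eq_iff)

lemma star_diff: "star (x - y) = star x - star y"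
  by (simp add: star_def vec_eq_iff)

lemma star_0 [simp]: "star 0 = 0"
  by (simp add: star_def vec_eq_iff)

lemma star_mat [simp]: "star (mat c) = mat (cnj c)"
  by (simp add: star_def vec_eq_iff mat_def)

lemma star_sum: "star (\<Sum>i\<in>I. f i) = (\<Sum>i\<in>I. star (f i))"
  by (induction I rule: infinite_finite_induct) (simp_all add: star_add)

text \<open>The Euclidean inner product of the type is the real part of the Hilbert-Schmidt one, so
  orthogonal decomposition of real subspaces can be combined with cyclicity of the trace.\<close>

lemma inner_cmat_eq_trace: "x \<bullet> y = Re (trace (star x ** (y :: 'n::finite cmat)))"
proof -
  have "x \<bullet> y = (\<Sum>i\<in>UNIV. \<Sum>j\<in>UNIV. Re (cnj (x $ i $ j) * y $ i $ j))"
    by (simp add: inner_vec_def inner_complex_def)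
  also have "\<dots> = (\<Sum>j\<in>UNIV. \<Sum>i\<in>UNIV. Re (cnj (x $ i $ j) * y $ i $ j))"
    by (rule sum.swap)
  also have "\<dots> = Re (trace (star x ** y))"
    by (simp add: trace_def matrix_matrix_mult_def star_def)
  finally show ?thesis .
qed

text \<open>The trace of the left side is a sum of two squared norms.\<close>

lemma star_mult_self_sum_eq_0:
  assumes "star x ** x + star y ** y = (0 :: 'n::finite cmat)"
  shows "x = 0"
proof -
  have "x \<bullet> x + y \<bullet> y = Re (trace (star x ** x + star y ** y))"
    by (simp add: inner_cmat_eq_trace trace_add)
  also have "\<dots> = 0"
    by (simp add: assms trace_def)
  finally have "x \<bullet> x = 0"
    by (smt (verit) inner_ge_zero)
  then show ?thesis by simp
qed

section \<open>Projections and their order\<close>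

lemma is_projectionD:
  assumes "is_projection p"
  shows "star p = p" "p ** p = p"
  using assms by (auto simp: is_projection_def selfadjoint_def)

lemma is_projectionI: "star p = p \<Longrightarrow> p ** p = p \<Longrightarrow> is_projection p"
  by (auto simp: is_projection_def selfadjoint_def)

lemma is_projection_0: "is_projection 0"
  by (simp add: is_projection_def selfadjoint_def)

lemma is_projection_mat_1: "is_projection (mat 1)"
  by (simp add: is_projection_def selfadjoint_def)

lemma is_projection_mult:
  assumes "is_projection p" "is_projection q" "p ** q = q ** p"
  shows "is_projection (p ** q)"
  using assms by (intro is_projectionI)
    (auto simp: is_projectionD star_mult, metis is_projectionD(2) matrix_mul_assoc)

lemma is_projection_complement: "is_projection p \<Longrightarrow> is_projection (mat 1 - p)"
  by (intro is_projectionI)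
    (simp_all add: is_projectionD star_diff matrix_diff_ldistrib matrix_diff_rdistrib)

lemma is_projection_imp_positive: "is_projection p \<Longrightarrow> positive p"
  unfolding positive_def by (rule exI[of _ p]) (simp add: is_projectionD)

text \<open>Compressing \<open>q - p = star y ** y\<close> by the complement \<open>r\<close> of
  \<open>q\<close> kills \<open>q\<close>, so two matrices of the form \<open>star x ** x\<close>
  add up to zero and \<open>p ** r\<close> vanishes. Conversely, absorption makes
  \<open>q - p\<close> itself a projection, hence positive.\<close>

lemma projection_op_le_iff:
  assumes p: "is_projection p" and q: "is_projection q"
  shows "op_le p q \<longleftrightarrow> q ** p = p"
proof
  assume "op_le p q"
  then obtain y where y: "q - p = star y ** y"
    unfolding op_le_def positive_def by blast
  define r where "r = mat 1 - q"
  have r: "star r = r" "r ** q = 0" "q ** r = 0"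
    using q by (simp_all add: r_def is_projectionD star_diff matrix_diff_ldistrib matrix_diff_rdistrib)
  have "star (p ** r) ** (p ** r) + star (y ** r) ** (y ** r) = r ** ((p ** p) ** r) + r ** ((star y ** y) ** r)"
    by (simp only: star_mult r is_projectionD(1)[OF p] matrix_mul_assoc)
  also have "\<dots> = r ** q ** r"
    unfolding y[symmetric] is_projectionD(2)[OF p]
    by (simp add: matrix_diff_ldistrib matrix_diff_rdistrib matrix_mul_assoc)
  also have "\<dots> = 0" by (simp add: r)
  finally have "p ** r = 0" by (rule star_mult_self_sum_eq_0)
  then have "p ** q = p"
    by (simp add: r_def matrix_diff_ldistrib)
  then have "star (p ** q) = star p" by simp
  then show "q ** p = p"
    using p q by (simp add: star_mult is_projectionD)
next
  assume qp: "q ** p = p"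
  then have "star (q ** p) = star p" by simp
  then have pq: "p ** q = p"
    using p q by (simp add: star_mult is_projectionD)
  have "is_projection (q - p)"
    using p q pq qp
    by (intro is_projectionI) (simp_all add: is_projectionD star_diff matrix_diff_ldistrib matrix_diff_rdistrib)
  then show "op_le p q"
    unfolding op_le_def by (rule is_projection_imp_positive)
qed

lemma projection_absorb_commute:
  assumes "is_projection p" "is_projection q" "q ** p = p"
  shows "p ** q = p"
  using assms by (metis is_projectionD(1) star_mult)

lemma projection_op_le_antisym:
  assumes "is_projection p" "is_projection q" "op_le p q" "op_le q p"
  shows "p = q"
  using assms projection_absorb_commute projection_op_le_iff by metis

lemma is_projection_sum:
  assumes "\<And>i. i \<in> I \<Longrightarrow> is_projection (p i)"
    and "\<And>i j. i \<in> I \<Longrightarrow> j \<in> I \<Longrightarrow> i \<noteq> j \<Longrightarrow> p i ** p j = 0"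
  shows "is_projection (\<Sum>i\<in>I. p i)"
proof (cases "finite I")
  case True
  have "(\<Sum>i\<in>I. p i) ** (\<Sum>i\<in>I. p i) = (\<Sum>i\<in>I. \<Sum>j\<in>I. p i ** p j)"
    by (simp add: matrix_sum_ldistrib matrix_sum_rdistrib) (rule sum.swap)
  also have "\<dots> = (\<Sum>i\<in>I. \<Sum>j\<in>I. if j = i then p i else 0)"
    using assms by (intro sum.cong refl) (auto simp: is_projectionD)
  also have "\<dots> = (\<Sum>i\<in>I. p i)"
    using True by simp
  finally show ?thesis
    using assms(1) by (intro is_projectionI) (simp_all add: star_sum is_projectionD)
qed (simp add: is_projection_0)

text \<open>The projection is the component in the right ideal \<open>R\<close> of the unit, for the inner
  product \<open>Re (trace (star x ** y))\<close>.\<close>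

lemma right_ideal_projection_exists:
  fixes R :: "'n::finite cmat set"
  assumes R: "subspace R" and ideal: "\<And>x y. x \<in> R \<Longrightarrow> x ** y \<in> R"
  shows "\<exists>p\<in>R. is_projection p \<and> (\<forall>x\<in>R. p ** x = x)"
proof -
  obtain p z where p: "p \<in> R" and z: "\<And>w. w \<in> R \<Longrightarrow> z \<bullet> w = 0" and pz: "mat 1 = p + z"
    using orthogonal_subspace_decomp_exists[of R "mat 1"] R
    by (metis orthogonal_def span_eq_iff)
  have zw: "star z ** w = 0" if "w \<in> R" for w
  proof -
    let ?y = "star z ** w"
    \<comment> \<open>Cyclicity of the trace moves \<open>star ?y\<close> behind \<open>w\<close>;
      the product stays in the right ideal, to which \<open>z\<close> is orthogonal.\<close>
    have "?y \<bullet> ?y = z \<bullet> (w ** star ?y)"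
      by (simp add: inner_cmat_eq_trace trace_mul_sym[of "star _"] star_mult matrix_mul_assoc)
        (metis matrix_mul_assoc trace_mul_sym)
    also have "\<dots> = 0" using ideal that z by blast
    finally show ?thesis by simp
  qed
  have z_eq: "star z = mat 1 - star p"
    using pz by (metis add_diff_cancel_left' star_diff star_mat complex_cnj_one)
  have w: "star p ** w = w" if "w \<in> R" for w
    using zw[OF that] by (simp add: z_eq matrix_diff_rdistrib)
  \<comment> \<open>The case \<open>w = p\<close> gives \<open>star p ** p = p\<close>, whose left
    side is selfadjoint.\<close>
  have "star p = p"
    using w[OF p] by (metis star_mult star_star)
  then show ?thesis
    using p w is_projectionI by metis
qed

section \<open>Spectral projections\<close>

text \<open>These are the matrices whose columns are joint eigenvectors for the eigenvalues
  \<open>l x\<close>. They form a right ideal, so a projection belongs to them; this serves for one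
  matrix as well as for a whole context.\<close>

lemma subspace_joint_eigenmatrices:
  fixes l :: "'n::finite cmat \<Rightarrow> complex"
  shows "subspace {y :: 'n cmat. \<forall>x\<in>S. x ** y = mat (l x) ** y}"
proof -
  have "x ** (c *\<^sub>R y) = mat (l x) ** (c *\<^sub>R y)" if "x ** y = mat (l x) ** y" for x y :: "'n cmat" and c
  proof -
    have "x ** (c *\<^sub>R y) = mat (complex_of_real c) ** (mat (l x) ** y)"
      unfolding scaleR_eq_mat_mult by (subst mat_mult_left_commute) (simp only: that)
    also have "\<dots> = mat (l x) ** (c *\<^sub>R y)"
      unfolding scaleR_eq_mat_mult by (rule mat_mult_left_commute[symmetric])
    finally show ?thesis .
  qed
  then show ?thesis
    unfolding subspace_def by (auto simp: matrix_add_ldistrib)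
qed

text \<open>A vector is encoded as the matrix with all columns equal to it, which carries facts
  about right ideals over to vectors.\<close>

lemma mult_constant_columns: "(x ** (\<chi> i j. v $ i)) $ i $ j = (x *v v) $ i"
  by (simp add: matrix_matrix_mult_def matrix_vector_mult_def)

text \<open>A projection fixes its range pointwise, so with equal ranges each projection absorbs the
  other, and antisymmetry applies.\<close>

lemma projection_eqI_range:
  assumes "is_projection p" "is_projection q" "range ((*v) p) = range ((*v) q)"
  shows "p = q"
proof -
  have absorb: "q ** p = p"
    if q: "is_projection q" and r: "range ((*v) p) = range ((*v) q)" for p q :: "'n::finite cmat"
  proof -
    have "(q ** p) *v v = p *v v" for v
    proof -
      obtain w where "p *v v = q *v w"
        using r by (metis rangeE rangeI)
      then show ?thesis
        using is_projectionD(2)[OF q] by (simp flip: matrix_vector_mul_assoc) (simp add: matrix_vector_mul_assoc)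
    qed
    then show ?thesis by (simp add: matrix_eq)
  qed
  show ?thesis
    using assms absorb[of q p] absorb[of p q]
    by (intro projection_op_le_antisym) (simp_all add: projection_op_le_iff)
qed

text \<open>This justifies the definite description: the projection of the right ideal of
  eigenmatrices has the eigenspace as its range, and the range determines a projection.\<close>

lemma eigenprojection:
  fixes a :: "'n::finite cmat"
  shows "is_projection (eigenprojection a r)" "range ((*v) (eigenprojection a r)) = eigenspace a r"
proof -
  define R :: "'n cmat set" where "R = {y. a ** y = mat (complex_of_real r) ** y}"
  have "subspace R"
    using subspace_joint_eigenmatrices[of "{a}" "\<lambda>_. complex_of_real r"] by (simp add: R_def)
  moreover have "x ** y \<in> R" if "x \<in> R" for x y
    using that by (simp add: R_def matrix_mul_assoc)
  ultimately obtain p where p: "is_projection p" "p \<in> R" "\<And>x. x \<in> R \<Longrightarrow> p ** x = x"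
    using right_ideal_projection_exists[of R] by blast
  have "p *v v \<in> eigenspace a r" for v
    using p(2) by (simp add: eigenspace_def R_def flip: mat_mult_vector) (simp add: matrix_vector_mul_assoc)
  moreover have "v \<in> range ((*v) p)" if v: "v \<in> eigenspace a r" for v
  proof -
    have "(\<chi> i j. v $ i) \<in> R"
      using v by (simp add: R_def eigenspace_def vec_eq_iff mult_constant_columns mat_mult_vector)
    from p(3)[OF this] have "p *v v = v"
      by (metis (no_types, lifting) mult_constant_columns vec_eq_iff vec_lambda_beta)
    then show ?thesis by (metis rangeI)
  qed
  ultimately have "range ((*v) p) = eigenspace a r" by blast
  with p(1) have "\<exists>!p. is_projection p \<and> range ((*v) p) = eigenspace a r"
    by (metis projection_eqI_range)
  from theI'[OF this] show "is_projection (eigenprojection a r)"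
    "range ((*v) (eigenprojection a r)) = eigenspace a r"
    by (simp_all add: eigenprojection_def)
qed

lemma mult_eigenprojection:
  "a ** eigenprojection a r = mat (complex_of_real r) ** eigenprojection a r"
proof -
  have "a *v (eigenprojection a r *v v) = mat (complex_of_real r) *v (eigenprojection a r *v v)" for v
    using eigenprojection(2)[of a r] by (auto simp: eigenspace_def mat_mult_vector)
  then show ?thesis
    by (simp add: matrix_eq matrix_vector_mul_assoc)
qed

text \<open>\<open>?p ** a ** ?q\<close> is evaluated from both sides: \<open>a\<close> scales
  \<open>?q\<close> by \<open>s\<close>, and the adjoint of the eigenvalue equation, with
  \<open>a\<close> selfadjoint and \<open>r\<close> real, makes it scale \<open>?p\<close> by
  \<open>r\<close>.\<close>

lemma eigenprojection_orthogonal: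
  assumes "selfadjoint a" "r \<noteq> s"
  shows "eigenprojection a r ** eigenprojection a s = 0"
proof (rule ccontr)
  let ?p = "eigenprojection a r" and ?q = "eigenprojection a s"
  assume nz: "?p ** ?q \<noteq> 0"
  have "star (a ** ?p) = star (mat (complex_of_real r) ** ?p)"
    by (simp add: mult_eigenprojection)
  then have "?p ** a = mat (complex_of_real r) ** ?p"
    using assms(1) eigenprojection(1)[of a r]
    by (simp add: star_mult selfadjoint_def is_projectionD mat_mult_commute)
  then have "mat (complex_of_real r) ** (?p ** ?q) = ?p ** (a ** ?q)"
    by (simp add: matrix_mul_assoc)
  also have "\<dots> = mat (complex_of_real s) ** (?p ** ?q)"
    by (simp add: mult_eigenprojection mat_mult_left_commute)
  finally show False
    using mat_mult_left_cancel[OF _ nz] assms(2) by force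
qed

lemma is_projection_spectral_projection:
  "selfadjoint a \<Longrightarrow> is_projection (spectral_projection \<Delta> a)"
  unfolding spectral_projection_def
  by (intro is_projection_sum) (simp_all add: eigenprojection(1) eigenprojection_orthogonal)

section \<open>Common eigenvectors of commuting matrices\<close>

text \<open>This is \<open>p(x) v\<close>, computed by Horner's scheme on vectors.\<close>

definition poly_apply :: "'n::finite cmat \<Rightarrow> complex poly \<Rightarrow> complex^'n \<Rightarrow> complex^'n" where
  "poly_apply x p v = fold_coeffs (\<lambda>c w. c *s v + x *v w) p 0"

lemma poly_apply_0 [simp]: "poly_apply x 0 v = 0"
  by (simp add: poly_apply_def)

lemma poly_apply_pCons [simp]: "poly_apply x (pCons c p) v = c *s v + x *v poly_apply x p v"
  by (cases "p = 0 \<and> c = 0") (auto simp: poly_apply_def)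

lemma poly_apply_add: "poly_apply x (p + q) v = poly_apply x p v + poly_apply x q v"
  by (induction p q rule: poly_induct2)
    (simp_all add: matrix_vector_right_distrib vector_sadd_rdistrib)

lemma poly_apply_smult: "poly_apply x (smult c p) v = c *s poly_apply x p v"
  by (induction p) (simp_all add: vector_add_ldistrib vector_smult_assoc vector_scalar_commute)

lemma poly_apply_sum: "poly_apply x (\<Sum>i\<in>I. p i) v = (\<Sum>i\<in>I. poly_apply x (p i) v)"
  by (induction I rule: infinite_finite_induct) (simp_all add: poly_apply_add)

lemma poly_apply_monom: "poly_apply x (monom c i) v = c *s (((*v) x) ^^ i) v"
  by (induction i) (simp_all add: monom_0 monom_Suc vector_scalar_commute)

lemma annihilating_poly_exists:
  fixes x :: "'n::finite cmat"
  shows "\<exists>p. p \<noteq> 0 \<and> poly_apply x p v = 0"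
proof -
  define f where "f i = (((*v) x) ^^ i) v" for i
  define N where "N = CARD('n)"
  show ?thesis
  \<comment> \<open>Linear dependence speaks of sets of vectors, so a repetition among the iterates
    is treated apart; it yields a difference of two monomials.\<close>
  proof (cases "inj_on f {..N}")
    case True
    \<comment> \<open>\<open>{..N}\<close> has \<open>N + 1\<close> indices, one more than the
      dimension.\<close>
    have "vec.dim (f ` {..N}) < card (f ` {..N})"
      using card_image[OF True] vec.dim_subset_UNIV[of "f ` {..N}"]
      by (simp add: N_def vec.dimension_def card_cart_basis)
    then have "vec.dependent (f ` {..N})"
      by (rule vec.dependent_biggerset_general)
    then obtain u where u: "\<exists>w\<in>f ` {..N}. u w \<noteq> 0" "(\<Sum>w\<in>f ` {..N}. u w *s w) = 0"
      by (subst (asm) vec.dependent_finite) auto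
    from u(1) obtain k where k: "k \<le> N" "u (f k) \<noteq> 0" by auto
    have "coeff (\<Sum>i\<le>N. monom (u (f i)) i) k \<noteq> 0"
      using k by (simp add: coeff_sum coeff_monom)
    moreover have "poly_apply x (\<Sum>i\<le>N. monom (u (f i)) i) v = 0"
      using u(2) by (simp add: poly_apply_sum poly_apply_monom sum.reindex[OF True] flip: f_def)
    ultimately show ?thesis by (metis coeff_0)
  next
    case False
    then obtain i j where ij: "i \<noteq> j" "f i = f j"
      by (auto simp: inj_on_def)
    have "coeff (monom 1 i + monom (-1) j :: complex poly) i \<noteq> 0"
      using ij by (simp add: coeff_monom)
    moreover have "poly_apply x (monom 1 i + monom (-1) j) v = 0"
      using ij by (simp add: poly_apply_add poly_apply_monom f_def)
    ultimately show ?thesis by (metis coeff_0)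
  qed
qed

text \<open>Split off a root \<open>z\<close>, so that \<open>p(x) v = (x - z) q(x) v\<close>.
  Either \<open>q(x) v\<close> is nonzero, and then it is an eigenvector in the invariant space
  \<open>V\<close>, or \<open>q\<close> annihilates \<open>v\<close> with a smaller degree.\<close>

lemma eigenvector_of_annihilating_poly:
  assumes V: "vec.subspace V" and inv: "\<And>w. w \<in> V \<Longrightarrow> x *v w \<in> V"
    and v: "v \<in> V" "v \<noteq> 0"
  shows "p \<noteq> 0 \<Longrightarrow> poly_apply x p v = 0 \<Longrightarrow> \<exists>w\<in>V. w \<noteq> 0 \<and> (\<exists>c. x *v w = c *s w)"
proof (induction "degree p" arbitrary: p rule: less_induct)
  case less
  show ?case
  proof (cases "degree p = 0")
    case True
    then obtain c where "p = [:c:]" by (metis degree_0_id)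
    then show ?thesis using less.prems v by simp
  next
    case False
    then have "\<not> constant (poly p)" by (simp add: constant_degree)
    then obtain z where "poly p z = 0" using fundamental_theorem_of_algebra by blast
    then obtain q where pq: "p = [:-z, 1:] * q"
      by (metis dvdE poly_eq_0_iff_dvd)
    have "q \<noteq> 0" using less.prems(1) pq by auto
    then have deg: "degree q < degree p"
      by (simp add: pq degree_mult_eq del: mult_pCons_left)
    \<comment> \<open>The product is written as a scalar multiple plus a shift, the forms on which
      \<open>poly_apply\<close> computes.\<close>
    have "p = smult (- z) q + pCons 0 q" by (simp add: pq)
    then have "poly_apply x p v = x *v poly_apply x q v - z *s poly_apply x q v"
      by (simp only: poly_apply_add poly_apply_smult poly_apply_pCons) (simp add: vector_smult_lneg)
    then have eig: "x *v poly_apply x q v = z *s poly_apply x q v"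
      using less.prems(2) by simp
    have "poly_apply x q v \<in> V"
    proof (induction q)
      case 0
      show ?case using V by (simp add: vec.subspace_0)
    next
      case (pCons a q)
      then show ?case using V v inv by (simp add: vec.subspace_add vec.subspace_scale)
    qed
    then show ?thesis
      using eig less.hyps[OF deg \<open>q \<noteq> 0\<close>] by blast
  qed
qed

text \<open>Induction on the dimension of \<open>V\<close>. If every member of \<open>S\<close> is
  scalar on \<open>V\<close>, any nonzero vector serves. Otherwise an eigenspace in \<open>V\<close>
  of a non-scalar member is nonzero, smaller, and invariant under \<open>S\<close> by
  commutativity.\<close>

lemma commuting_family_eigenvector:
  fixes S :: "'n::finite cmat set"
  assumes comm: "\<And>x y. x \<in> S \<Longrightarrow> y \<in> S \<Longrightarrow> x ** y = y ** x"
  shows "vec.subspace V \<Longrightarrow> (\<And>x w. x \<in> S \<Longrightarrow> w \<in> V \<Longrightarrow> x *v w \<in> V) \<Longrightarrow> v \<in> V \<Longrightarrow> v \<noteq> 0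
    \<Longrightarrow> \<exists>w\<in>V. w \<noteq> 0 \<and> (\<forall>x\<in>S. \<exists>c. x *v w = c *s w)"
proof (induction "vec.dim V" arbitrary: V v rule: less_induct)
  case less
  note V = less.prems(1) and inv = less.prems(2)
  show ?case
  proof (cases "\<forall>x\<in>S. \<exists>c. \<forall>w\<in>V. x *v w = c *s w")
    case True
    then show ?thesis using less.prems by blast
  next
    case False
    then obtain x where x: "x \<in> S" "\<And>c. \<exists>w\<in>V. x *v w \<noteq> c *s w" by blast
    obtain u c where u: "u \<in> V" "u \<noteq> 0" "x *v u = c *s u"
      using annihilating_poly_exists[of x v] eigenvector_of_annihilating_poly[OF V inv[OF x(1)] less.prems(3,4)]
      by blast
    define W where "W = {w \<in> V. x *v w = c *s w}"
    have W: "vec.subspace W"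
      using V unfolding W_def vec.subspace_def
      by (auto simp: matrix_vector_right_distrib vector_add_ldistrib vector_scalar_commute vector_smult_assoc mult.commute)
    have "W \<subset> V" using x(2)[of c] unfolding W_def by blast
    then have "vec.dim W < vec.dim V"
      using W V by (intro vec.dim_psubset) (simp add: vec.span_eq_iff[THEN iffD2])
    moreover have "y *v w \<in> W" if "y \<in> S" "w \<in> W" for y w
    proof -
      have "x *v (y *v w) = y *v (x *v w)"
        using comm[OF x(1) that(1)] by (simp add: matrix_vector_mul_assoc)
      also have "\<dots> = c *s (y *v w)"
        using that(2) by (simp add: W_def vector_scalar_commute)
      finally show ?thesis using that inv by (simp add: W_def)
    qed
    moreover have "u \<in> W" using u by (simp add: W_def)
    ultimately obtain w where "w \<in> W" "w \<noteq> 0" "\<forall>x\<in>S. \<exists>c. x *v w = c *s w"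
      using less.hyps[of W u] W u(2) by blast
    then show ?thesis unfolding W_def by blast
  qed
qed

section \<open>Characters of a context\<close>

text \<open>The projection onto the joint eigenspace of \<open>S\<close> for the eigenvalues
  \<open>l x\<close>. Here \<open>l\<close> is any function; the projection is zero if there is no
  nonzero joint eigenvector.\<close>

definition character_projection :: "'n::finite cmat set \<Rightarrow> ('n cmat \<Rightarrow> complex) \<Rightarrow> 'n cmat" where
  "character_projection S l = (SOME p. is_projection p \<and> (\<forall>x\<in>S. x ** p = mat (l x) ** p) \<and>
     (\<forall>y :: 'n cmat. (\<forall>x\<in>S. x ** y = mat (l x) ** y) \<longrightarrow> p ** y = y))"

lemma
  fixes S :: "'n::finite cmat set"
  shows is_projection_character_projection: "is_projection (character_projection S l)"
    and mult_character_projection: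
      "x \<in> S \<Longrightarrow> x ** character_projection S l = mat (l x) ** character_projection S l"
    and character_projection_absorb:
      "(\<And>x. x \<in> S \<Longrightarrow> x ** y = mat (l x) ** (y :: 'n cmat)) \<Longrightarrow> character_projection S l ** y = y"
proof -
  define R where "R = {y :: 'n cmat. \<forall>x\<in>S. x ** y = mat (l x) ** y}"
  have "subspace R"
    unfolding R_def by (rule subspace_joint_eigenmatrices)
  moreover have "x ** y \<in> R" if "x \<in> R" for x y
    using that by (simp add: R_def matrix_mul_assoc)
  ultimately have "\<exists>p\<in>R. is_projection p \<and> (\<forall>x\<in>R. p ** x = x)"
    by (rule right_ideal_projection_exists)
  then have "\<exists>p. is_projection p \<and> (\<forall>x\<in>S. x ** p = mat (l x) ** p) \<and>
     (\<forall>y :: 'n cmat. (\<forall>x\<in>S. x ** y = mat (l x) ** y) \<longrightarrow> p ** y = y)"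
    unfolding R_def by blast
  from someI_ex[OF this] have *: "is_projection (character_projection S l)"
    "\<forall>x\<in>S. x ** character_projection S l = mat (l x) ** character_projection S l"
    "\<forall>y :: 'n cmat. (\<forall>x\<in>S. x ** y = mat (l x) ** y) \<longrightarrow> character_projection S l ** y = y"
    unfolding character_projection_def[symmetric] by blast+
  show "is_projection (character_projection S l)" by fact
  show "x \<in> S \<Longrightarrow> x ** character_projection S l = mat (l x) ** character_projection S l"
    using *(2) by blast
  show "(\<And>x. x \<in> S \<Longrightarrow> x ** y = mat (l x) ** (y :: 'n cmat)) \<Longrightarrow> character_projection S l ** y = y"
    using *(3) by blast
qed

section \<open>Closure rules for contexts and characters\<close>

lemma contextD:
  assumes "C \<in> contexts"
  shows "mat c \<in> C" "x \<in> C \<Longrightarrow> y \<in> C \<Longrightarrow> x + y \<in> C" "x \<in> C \<Longrightarrow> y \<in> C \<Longrightarrow> x ** y \<in> C"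
    "x \<in> C \<Longrightarrow> star x \<in> C" "commutant (commutant C) = C" "x \<in> C \<Longrightarrow> y \<in> C \<Longrightarrow> x ** y = y ** x"
  using assms unfolding contexts_def von_neumann_subalgebra_def by blast+

lemma context_diff:
  assumes "C \<in> contexts" "x \<in> C" "y \<in> C"
  shows "x - y \<in> C"
proof -
  have "x + mat (- 1) ** y \<in> C"
    using assms contextD by metis
  moreover have "mat (- 1) ** y = - y"
    by (simp add: vec_eq_iff mat_mult_component)
  ultimately show ?thesis by simp
qed

lemma context_sum:
  assumes "C \<in> contexts" "\<And>i. i \<in> I \<Longrightarrow> f i \<in> C"
  shows "(\<Sum>i\<in>I. f i) \<in> C"
  using assms(2) contextD(1)[OF assms(1), of 0]
  by (induction I rule: infinite_finite_induct) (auto intro: contextD(2)[OF assms(1)])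

lemma gelfandD:
  assumes "l \<in> gelfand C"
  shows "l (mat c) = c" "x \<in> C \<Longrightarrow> y \<in> C \<Longrightarrow> l (x + y) = l x + l y"
    "x \<in> C \<Longrightarrow> y \<in> C \<Longrightarrow> l (x ** y) = l x * l y" "l \<in> extensional C"
  using assms unfolding gelfand_def by blast+

lemma gelfand_sum:
  assumes "C \<in> contexts" "l \<in> gelfand C" "\<And>i. i \<in> I \<Longrightarrow> f i \<in> C"
  shows "l (\<Sum>i\<in>I. f i) = (\<Sum>i\<in>I. l (f i))"
  using assms(3)
proof (induction I rule: infinite_finite_induct)
  case (insert i I)
  then show ?case
    by (simp add: gelfandD(2)[OF assms(2)] context_sum[OF assms(1)])
qed (use gelfandD(1)[OF assms(2), of 0] in simp_all)

text \<open>By the double commutant condition it suffices to commute with the commutant, whose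
  members map the joint eigenspace into itself.\<close>

lemma character_projection_in_context:
  assumes C: "C \<in> contexts"
  shows "character_projection C l \<in> C"
proof -
  let ?q = "character_projection C l"
  have absorb: "?q ** (y ** ?q) = y ** ?q" if "y \<in> commutant C" for y
  proof (rule character_projection_absorb)
    fix x assume x: "x \<in> C"
    have "x ** (y ** ?q) = y ** (x ** ?q)"
      using that x by (simp add: commutant_def matrix_mul_assoc)
    also have "\<dots> = mat (l x) ** (y ** ?q)"
      by (simp add: mult_character_projection[OF x] mat_mult_left_commute)
    finally show "x ** (y ** ?q) = mat (l x) ** (y ** ?q)" .
  qed
  have "?q \<in> commutant (commutant C)"
    unfolding commutant_def[of "commutant C"]
  proof (intro CollectI ballI)
    fix y assume y: "y \<in> commutant C"
    \<comment> \<open>Invariance under \<open>star y\<close> as well turns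
      \<open>?q ** y ** ?q = y ** ?q\<close> into commutation.\<close>
    have "star y \<in> commutant C"
      unfolding commutant_def
    proof (intro CollectI ballI)
      fix x assume "x \<in> C"
      then have "star (y ** star x) = star (star x ** y)"
        using y contextD(4)[OF C] by (simp add: commutant_def)
      then show "star y ** x = x ** star y"
        by (simp add: star_mult)
    qed
    from absorb[OF this] have "star (?q ** (star y ** ?q)) = star (star y ** ?q)"
      by simp
    then have "?q ** y ** ?q = ?q ** y"
      by (simp add: star_mult is_projectionD(1)[OF is_projection_character_projection])
    then show "?q ** y = y ** ?q"
      using absorb[OF y] by (simp add: matrix_mul_assoc)
  qed
  then show ?thesis by (simp add: contextD(5)[OF C])
qed

text \<open>Distinct characters differ at some \<open>x\<close> in \<open>C\<close>, being both
  \<open>undefined\<close> elsewhere, and \<open>x\<close> scales the product of the projections by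
  either value.\<close>

lemma character_projection_orthogonal:
  assumes C: "C \<in> contexts" and l: "l \<in> gelfand C" "l' \<in> gelfand C" "l \<noteq> l'"
  shows "character_projection C l ** character_projection C l' = 0"
proof (rule ccontr)
  let ?p = "character_projection C l" and ?q = "character_projection C l'"
  assume nz: "?p ** ?q \<noteq> 0"
  obtain x where x: "x \<in> C" "l x \<noteq> l' x"
    using extensionalityI[OF gelfandD(4)[OF l(1)] gelfandD(4)[OF l(2)]] l(3) by blast
  have "mat (l x) ** (?p ** ?q) = (x ** ?p) ** ?q"
    by (simp add: mult_character_projection[OF x(1)] matrix_mul_assoc)
  also have "x ** ?p = ?p ** x"
    by (rule contextD(6)[OF C x(1) character_projection_in_context[OF C]])
  also have "?p ** x ** ?q = mat (l' x) ** (?p ** ?q)"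
    by (simp add: mult_character_projection[OF x(1)] mat_mult_left_commute flip: matrix_mul_assoc)
  finally show False
    using mat_mult_left_cancel nz x(2) by blast
qed

text \<open>Such projections are orthogonal for the trace inner product, hence linearly independent
  in a finite-dimensional real space.\<close>

lemma finite_orthogonal_projections:
  fixes q :: "'i \<Rightarrow> 'n::finite cmat"
  assumes "\<And>i. i \<in> I \<Longrightarrow> is_projection (q i)" "\<And>i. i \<in> I \<Longrightarrow> q i \<noteq> 0"
    and orth: "\<And>i j. i \<in> I \<Longrightarrow> j \<in> I \<Longrightarrow> i \<noteq> j \<Longrightarrow> q i ** q j = 0"
  shows "finite I"
proof -
  have "inj_on q I"
    using assms by (intro inj_onI) (metis is_projectionD(2))
  moreover have "q i ** q j = 0" if "i \<in> I" "j \<in> I" "q i \<noteq> q j" for i j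
    using orth that by metis
  then have "pairwise orthogonal (q ` I)"
    unfolding pairwise_def orthogonal_def
    using assms(1) by (auto simp: inner_cmat_eq_trace is_projectionD trace_def)
  then have "finite (q ` I)"
    using assms(2) by (intro independent_imp_finite pairwise_orthogonal_independent) auto
  ultimately show ?thesis
    by (rule finite_imageD[rotated])
qed

text \<open>The character sends a matrix to its eigenvalue at \<open>w\<close>. As \<open>w\<close>
  is nonzero, the homomorphism laws can be checked on multiples of \<open>w\<close>.\<close>

lemma joint_eigenvector_character:
  fixes C :: "'n::finite cmat set"
  assumes C: "C \<in> contexts" and w: "w \<noteq> 0" "\<forall>x\<in>C. \<exists>c. x *v w = c *s w"
  obtains l where "l \<in> gelfand C" "character_projection C l *v w = w"
proof -
  obtain l0 where l0: "\<And>x. x \<in> C \<Longrightarrow> x *v w = l0 x *s w"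
    using w(2) by metis
  define l where "l = restrict l0 C"
  have l: "x *v w = l x *s w" if "x \<in> C" for x
    using l0 that by (simp add: l_def)
  have cancel: "a = b" if "a *s w = b *s w" for a b
    using that w(1) by (simp add: vec.scale_right_imp_eq)
  have "l (mat c) = c" for c
    using l[OF contextD(1)[OF C]] by (intro cancel) (metis mat_mult_vector)
  moreover have "l (x + y) = l x + l y" if "x \<in> C" "y \<in> C" for x y
    using that contextD(2)[OF C that] by (intro cancel)
      (simp add: vector_sadd_rdistrib matrix_vector_mult_add_rdistrib flip: l)
  moreover have "l (x ** y) = l x * l y" if xy: "x \<in> C" "y \<in> C" for x y
  proof (rule cancel)
    have "l (x ** y) *s w = x *v (y *v w)"
      using l[OF contextD(3)[OF C xy]] by (simp add: matrix_vector_mul_assoc)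
    also have "\<dots> = (l x * l y) *s w"
      using xy by (simp add: l vector_scalar_commute vector_smult_assoc mult.commute)
    finally show "l (x ** y) *s w = (l x * l y) *s w" .
  qed
  ultimately have gelfand: "l \<in> gelfand C"
    by (simp add: gelfand_def l_def)
  have "character_projection C l ** (\<chi> i j. w $ i) = ((\<chi> i j. w $ i) :: 'n cmat)"
  proof (rule character_projection_absorb)
    fix x assume "x \<in> C"
    then show "x ** (\<chi> i j. w $ i) = mat (l x) ** (\<chi> i j. w $ i)"
      by (simp add: vec_eq_iff mult_constant_columns l mat_mult_vector)
  qed
  then have "character_projection C l *v w = w"
    by (metis (no_types, lifting) mult_constant_columns vec_eq_iff vec_lambda_beta)
  with gelfand show thesis by (rule that)
qed

text \<open>Let \<open>P\<close> be the sum of the nonzero projections. Were \<open>P\<close> not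
  the unit, its kernel would contain a joint eigenvector, yet the projection of the character of
  that vector fixes it and is absorbed by \<open>P\<close>. Once \<open>P\<close> is the unit, every
  character is found among those summed.\<close>

lemma
  fixes C :: "'n::finite cmat set"
  assumes C: "C \<in> contexts"
  shows finite_gelfand: "finite (gelfand C)"
    and sum_character_projection: "(\<Sum>l\<in>gelfand C. character_projection C l) = mat 1"
    and character_projection_nonzero: "l \<in> gelfand C \<Longrightarrow> character_projection C l \<noteq> 0"
proof -
  let ?q = "character_projection C"
  \<comment> \<open>Restricting to nonzero projections makes the index set finite by orthogonality;
    that it is the whole spectrum is shown last.\<close>
  define L where "L = {l \<in> gelfand C. ?q l \<noteq> 0}"
  have L: "finite L"
    using character_projection_orthogonal[OF C]
    by (intro finite_orthogonal_projections[of L ?q])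
      (auto simp: L_def is_projection_character_projection)
  define P where "P = (\<Sum>l\<in>L. ?q l)"
  have PC: "P \<in> C"
    unfolding P_def by (intro context_sum[OF C] character_projection_in_context[OF C])
  have Pq: "P ** ?q l = ?q l" if "l \<in> L" for l
  proof -
    have "P ** ?q l = (\<Sum>l'\<in>L. if l' = l then ?q l else 0)"
      unfolding P_def matrix_sum_rdistrib
      using that by (intro sum.cong refl)
        (auto simp: L_def character_projection_orthogonal[OF C] is_projectionD(2)[OF is_projection_character_projection])
    then show ?thesis using L that by simp
  qed
  have P_idem: "P ** P = P"
    using Pq by (subst (2 3) P_def) (simp add: matrix_sum_ldistrib)
  have P: "P = mat 1"
  proof (rule ccontr)
    assume "P \<noteq> mat 1"
    then obtain u where u: "P *v u \<noteq> u"
      by (auto simp: matrix_eq)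
    define V where "V = {v. P *v v = 0}"
    have "vec.subspace V"
      unfolding V_def vec.subspace_def
      by (auto simp: matrix_vector_right_distrib vector_scalar_commute)
    moreover have "x *v v \<in> V" if "x \<in> C" "v \<in> V" for x v
      using that contextD(6)[OF C PC that(1)]
      by (simp add: V_def matrix_vector_mul_assoc) (simp flip: matrix_vector_mul_assoc)
    moreover have "u - P *v u \<in> V"
      by (simp add: V_def matrix_vector_mult_diff_distrib matrix_vector_mul_assoc P_idem)
    ultimately obtain w where w: "w \<in> V" "w \<noteq> 0" "\<forall>x\<in>C. \<exists>c. x *v w = c *s w"
      using commuting_family_eigenvector[of C V "u - P *v u"] contextD(6)[OF C] u by auto
    obtain l where l: "l \<in> gelfand C" "?q l *v w = w"
      using joint_eigenvector_character[OF C w(2,3)] by blast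
    then have "l \<in> L"
      using w(2) by (auto simp: L_def)
    have "P *v (?q l *v w) = ?q l *v w"
      by (simp add: matrix_vector_mul_assoc Pq[OF \<open>l \<in> L\<close>])
    then show False
      using w l by (simp add: V_def)
  qed
  have "gelfand C \<subseteq> L"
  proof
    fix l assume l: "l \<in> gelfand C"
    \<comment> \<open>The values of \<open>l\<close> at the projections add up to one, so some
      \<open>l (?q l')\<close> is nonzero; cancelling it in \<open>l (x ** ?q l')\<close> gives
      \<open>l = l'\<close>.\<close>
    have "(\<Sum>l'\<in>L. l (?q l')) = 1"
      using gelfand_sum[OF C l, of L ?q] character_projection_in_context[OF C]
        gelfandD(1)[OF l, of 1] P by (simp add: P_def)
    then obtain l' where l': "l' \<in> L" "l (?q l') \<noteq> 0"
      by (metis sum.neutral zero_neq_one)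
    have "l x = l' x" if x: "x \<in> C" for x
    proof -
      have "l (x ** ?q l') = l (mat (l' x) ** ?q l')"
        by (simp add: mult_character_projection[OF x])
      then have "l x * l (?q l') = l' x * l (?q l')"
        using x by (simp add: gelfandD[OF l] character_projection_in_context[OF C] contextD(1)[OF C])
      then show ?thesis using l'(2) by simp
    qed
    then have "l = l'"
      using gelfandD(4)[OF l] gelfandD(4)[of l' C] l'(1)
      by (auto simp: L_def intro: extensionalityI)
    then show "l \<in> L" using l' by simp
  qed
  then have "L = gelfand C" by (auto simp: L_def)
  then show "finite (gelfand C)" "(\<Sum>l\<in>gelfand C. ?q l) = mat 1" "l \<in> gelfand C \<Longrightarrow> ?q l \<noteq> 0"
    using L P unfolding P_def L_def by auto
qed

text \<open>\<open>?q ** ?p\<close> is evaluated twice: \<open>?q\<close> acts on \<open>?p\<close>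
  by the scalar \<open>l ?q\<close>, and orthogonality or idempotence gives the other value.\<close>

lemma character_character_projection:
  assumes C: "C \<in> contexts" and l: "l \<in> gelfand C" "l' \<in> gelfand C"
  shows "l (character_projection C l') = (if l' = l then 1 else 0)"
proof -
  let ?p = "character_projection C l" and ?q = "character_projection C l'"
  have "mat (l ?q) ** ?p = ?q ** ?p"
    by (rule mult_character_projection[OF character_projection_in_context[OF C], symmetric])
  also have "\<dots> = mat (if l' = l then 1 else 0) ** ?p"
    using l by (simp add: character_projection_orthogonal[OF C] is_projectionD(2)[OF is_projection_character_projection])
  finally show ?thesis
    by (rule mat_mult_left_cancel) (rule character_projection_nonzero[OF C l(1)])
qed

lemma context_spectral_decomposition:
  assumes C: "C \<in> contexts" and x: "x \<in> C"
  shows "x = (\<Sum>l\<in>gelfand C. mat (l x) ** character_projection C l)"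
proof -
  have "x = x ** (\<Sum>l\<in>gelfand C. character_projection C l)"
    by (simp add: sum_character_projection[OF C])
  then show ?thesis
    by (simp add: matrix_sum_ldistrib mult_character_projection[OF x])
qed

section \<open>Daseinisation and elementary propositions\<close>

lemma ProjD: "p \<in> Proj C \<Longrightarrow> p \<in> C" "p \<in> Proj C \<Longrightarrow> is_projection p"
  by (auto simp: Proj_def)

lemma Proj_mult:
  assumes "C \<in> contexts" "p \<in> Proj C" "q \<in> Proj C"
  shows "p ** q \<in> Proj C"
  using assms contextD(3,6)[OF assms(1)] by (auto simp: Proj_def intro: is_projection_mult)

lemma Proj_complement: "C \<in> contexts \<Longrightarrow> p \<in> Proj C \<Longrightarrow> mat 1 - p \<in> Proj C"
  by (simp add: Proj_def context_diff contextD(1) is_projection_complement)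

lemma proj_lattice_simps [simp]:
  "carrier (proj_lattice C) = Proj C" "le (proj_lattice C) = op_le"
  by (simp_all add: proj_lattice_def)

text \<open>The infimum is an upper bound of \<open>p\<close> whose range has the least dimension: multiplying
  it by another upper bound cannot shrink the range.\<close>

lemma outer_das_exists:
  fixes C :: "'n::finite cmat set"
  assumes C: "C \<in> contexts" and p: "is_projection p"
  shows "\<exists>m\<in>Proj C. op_le p m \<and> (\<forall>q\<in>Proj C. op_le p q \<longrightarrow> op_le m q)"
proof -
  define S where "S = {q \<in> Proj C. op_le p q}"
  define d where "d q = vec.dim (range ((*v) q))" for q :: "'n cmat"
  have "mat 1 \<in> S"
    using p by (simp add: S_def Proj_def contextD(1)[OF C] is_projection_mat_1 projection_op_le_iff)
  then obtain m where m: "m \<in> S" and min: "\<And>q. q \<in> S \<Longrightarrow> d m \<le> d q"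
    using ex_has_least_nat[of "\<lambda>q. q \<in> S" _ d] by blast
  have sub: "vec.subspace (range ((*v) q))" for q :: "'n cmat"
    by (rule vec.subspace_image) (rule vec.subspace_UNIV)
  have "op_le m q" if q: "q \<in> S" for q
  proof -
    have mP: "m \<in> Proj C" and qP: "q \<in> Proj C"
      using m q by (auto simp: S_def)
    have mq: "m ** q \<in> Proj C"
      by (rule Proj_mult[OF C mP qP])
    have "op_le p (m ** q)"
      using m q mP qP mq p
      by (simp add: S_def projection_op_le_iff ProjD) (simp flip: matrix_mul_assoc)
    with mq have "m ** q \<in> S" by (simp add: S_def)
    then have "range ((*v) (m ** q)) = range ((*v) m)"
      using min[of "m ** q"] unfolding d_def
      by (intro vec.subspace_dim_equal sub) (auto simp flip: matrix_vector_mul_assoc)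
    \<comment> \<open>Every value of \<open>m\<close> is thus a value of \<open>m ** q\<close>, and
      \<open>q\<close> fixes these because it commutes with \<open>m\<close>.\<close>
    then have rng: "\<exists>w. m *v v = (m ** q) *v w" for v
      by (metis rangeE rangeI)
    have "q ** m ** q = m ** q"
      using contextD(6)[OF C ProjD(1)[OF mP] ProjD(1)[OF qP]] is_projectionD(2)[OF ProjD(2)[OF qP]]
      by (metis matrix_mul_assoc)
    have "(q ** m) *v v = m *v v" for v
    proof -
      obtain w where w: "m *v v = (m ** q) *v w" using rng by blast
      have "(q ** m) *v v = q *v ((m ** q) *v w)"
        by (simp only: w flip: matrix_vector_mul_assoc)
      also have "\<dots> = m *v v"
        by (simp only: matrix_vector_mul_assoc matrix_mul_assoc \<open>q ** m ** q = m ** q\<close> w)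
      finally show ?thesis .
    qed
    then have "q ** m = m" by (simp add: matrix_eq)
    then show ?thesis
      by (simp add: projection_op_le_iff ProjD(2)[OF mP] ProjD(2)[OF qP])
  qed
  with m show ?thesis unfolding S_def by blast
qed

text \<open>The lattice infimum chooses some greatest lower bound. The least element of the set is
  one, and antisymmetry makes it the only one.\<close>

lemma
  assumes C: "C \<in> contexts" and p: "is_projection p"
  shows outer_das_Proj: "outer_das p C \<in> Proj C"
    and op_le_outer_das: "op_le p (outer_das p C)"
    and outer_das_least: "q \<in> Proj C \<Longrightarrow> op_le p q \<Longrightarrow> op_le (outer_das p C) q"
proof -
  define A where "A = {q \<in> Proj C. op_le p q}"
  obtain m where m: "m \<in> A" "\<And>q. q \<in> A \<Longrightarrow> op_le m q"
    using outer_das_exists[OF C p] unfolding A_def by blast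
  have "greatest (proj_lattice C) m (Lower (proj_lattice C) A)"
    using m unfolding greatest_def Lower_def by (auto simp: A_def)
  moreover have "m' = m" if "greatest (proj_lattice C) m' (Lower (proj_lattice C) A)" for m'
  proof (rule projection_op_le_antisym)
    show "op_le m' m" "op_le m m'" "is_projection m'" "is_projection m"
      using that m unfolding greatest_def Lower_def by (auto simp: A_def ProjD)
  qed
  ultimately have "outer_das p C = m"
    unfolding outer_das_def Lattice.inf_def A_def[symmetric] by (rule some_equality)
  with m show "outer_das p C \<in> Proj C" "op_le p (outer_das p C)"
    "q \<in> Proj C \<Longrightarrow> op_le p q \<Longrightarrow> op_le (outer_das p C) q"
    by (auto simp: A_def)
qed

section \<open>Clopen sets of projections and openness of the elementary propositions\<close>

lemma gelfand_projection_values: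
  assumes "l \<in> gelfand C" "p \<in> Proj C"
  shows "l p = 0 \<or> l p = 1"
proof -
  have "l p * l p = l p"
    using assms gelfandD(3)[OF assms(1), of p p] by (simp add: Proj_def is_projectionD)
  then show ?thesis by simp
qed

lemma openin_gelfand_projection:
  assumes p: "p \<in> Proj C"
  shows "openin (gelfand_topology C) {l \<in> gelfand C. l p = 1}"
proof -
  have "continuous_map (gelfand_topology C) euclidean (\<lambda>l. l p)"
    unfolding gelfand_topology_def
    by (intro continuous_map_from_subtopology continuous_map_product_projection ProjD(1)[OF p])
  \<comment> \<open>The open ball of radius one about 1 excludes 0, the only other value of a
    character at a projection.\<close>
  then have "openin (gelfand_topology C)
      {l \<in> topspace (gelfand_topology C). l p \<in> ball 1 1}"
    by (rule openin_continuous_map_preimage) simp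
  moreover have "{l \<in> topspace (gelfand_topology C). l p \<in> ball 1 1} = {l \<in> gelfand C. l p = 1}"
    using gelfand_projection_values[OF _ p] by (force simp: topspace_gelfand_topology)
  ultimately show ?thesis by simp
qed

lemma restrict_gelfand:
  assumes "l \<in> gelfand C" "D \<in> contexts" "D \<subseteq> C"
  shows "restrict l D \<in> gelfand D"
  using assms(1,3) contextD[OF assms(2)] unfolding gelfand_def by (auto simp: subset_iff)

text \<open>Daseinisation grows when the context shrinks: the projection found in \<open>D\<close>
  is also an upper bound in \<open>C\<close>. A character with value one at the smaller projection
  has value one at the larger.\<close>

lemma Sigma_open_elem_prop:
  assumes a: "selfadjoint a"
  shows "Sigma_open (elem_prop a \<Delta>)"
  unfolding Sigma_open_def
proof (intro conjI allI impI ballI)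
  let ?d = "outer_das (spectral_projection \<Delta> a)"
  note p = is_projection_spectral_projection[OF a, of \<Delta>]
  show "elem_prop a \<Delta> \<subseteq> Sigma contexts gelfand"
    by (auto simp: elem_prop_def)
  show "(D, restrict l D) \<in> elem_prop a \<Delta>"
    if "(C, l) \<in> elem_prop a \<Delta>" "D \<in> contexts" "D \<subseteq> C" for C l D
  proof -
    from that have C: "C \<in> contexts" and l: "l \<in> gelfand C" "l (?d C) = 1"
      by (auto simp: elem_prop_def)
    have dD: "?d D \<in> Proj D"
      by (rule outer_das_Proj[OF that(2) p])
    then have dDC: "?d D \<in> Proj C"
      using that(3) by (auto simp: Proj_def)
    have dC: "?d C \<in> Proj C"
      by (rule outer_das_Proj[OF C p])
    have "op_le (?d C) (?d D)"
      using outer_das_least[OF C p dDC] op_le_outer_das[OF that(2) p] by blast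
    then have "?d D ** ?d C = ?d C"
      using dC dDC by (simp add: projection_op_le_iff ProjD)
    then have "l (?d D) * l (?d C) = l (?d C)"
      using dC dDC gelfandD(3)[OF l(1), of "?d D" "?d C"] by (simp add: ProjD)
    then show ?thesis
      using l that dD restrict_gelfand[OF l(1) that(2,3)] by (simp add: elem_prop_def ProjD)
  qed
  show "openin (gelfand_topology C) (elem_prop a \<Delta> `` {C})" if C: "C \<in> contexts" for C
  proof -
    have "elem_prop a \<Delta> `` {C} = {l \<in> gelfand C. l (?d C) = 1}"
      using C by (auto simp: elem_prop_def)
    then show ?thesis
      by (simp add: openin_gelfand_projection[OF outer_das_Proj[OF C p]])
  qed
qed

text \<open>Since the intersection is open, it is the unique greatest lower bound, which settles the
  choice in the lattice infimum.\<close>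

lemma Sigma_frame_meet:
  assumes "Sigma_open U" "Sigma_open V"
  shows "U \<sqinter>\<^bsub>Sigma_frame\<^esub> V = U \<inter> V"
proof -
  have UV: "Sigma_open (U \<inter> V)"
    using assms istopology_Sigma_open unfolding istopology_def by blast
  show ?thesis
    unfolding meet_def Lattice.inf_def
  proof (rule some_equality)
    have lower: "Lower Sigma_frame {U, V} = {W. Sigma_open W \<and> W \<subseteq> U \<and> W \<subseteq> V}"
      using assms by (auto simp: Lower_def Sigma_frame_def openin_Sigma_down)
    have greatest: "greatest Sigma_frame W (Lower Sigma_frame {U, V}) \<longleftrightarrow>
        Sigma_open W \<and> W \<subseteq> U \<and> W \<subseteq> V \<and> (\<forall>X. Sigma_open X \<and> X \<subseteq> U \<and> X \<subseteq> V \<longrightarrow> X \<subseteq> W)" for W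
      unfolding lower by (auto simp: greatest_def Sigma_frame_def openin_Sigma_down)
    show "greatest Sigma_frame (U \<inter> V) (Lower Sigma_frame {U, V})"
      unfolding greatest using UV by blast
    show "W = U \<inter> V" if "greatest Sigma_frame W (Lower Sigma_frame {U, V})" for W
    proof (rule equalityI)
      show "W \<subseteq> U \<inter> V" using that unfolding greatest by blast
      show "U \<inter> V \<subseteq> W" using that UV unfolding greatest by (meson inf_le1 inf_le2)
    qed
  qed
qed

section \<open>States and Riesz--Markov measures\<close>

lemma is_stateD:
  assumes "is_state \<psi>"
  shows "\<psi> (x + y) = \<psi> x + \<psi> y" "\<psi> (mat c ** x) = c * \<psi> x" "positive x \<Longrightarrow> \<psi> x \<in> \<real>\<^sub>\<ge>\<^sub>0" "\<psi> (mat 1) = 1"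
  using assms unfolding is_state_def by blast+

lemma state_diff:
  assumes "is_state \<psi>"
  shows "\<psi> (x - y) = \<psi> x - \<psi> y"
  using is_stateD(1)[OF assms, of "x - y" y] by simp

lemma state_sum:
  assumes "is_state \<psi>"
  shows "\<psi> (\<Sum>i\<in>I. f i) = (\<Sum>i\<in>I. \<psi> (f i))"
proof -
  have "\<psi> 0 = 0" using is_stateD(1)[OF assms, of 0 0] by simp
  then show ?thesis
    by (induction I rule: infinite_finite_induct) (simp_all add: is_stateD(1)[OF assms])
qed

lemma state_projection:
  assumes "is_state \<psi>" "is_projection p"
  shows "\<psi> p = complex_of_real (Re (\<psi> p))" "0 \<le> Re (\<psi> p)"
  using is_stateD(3)[OF assms(1) is_projection_imp_positive[OF assms(2)]]
  by (auto simp: complex_nonneg_Reals_iff complex_eq_iff)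

lemma state_projection_mono:
  assumes "is_state \<psi>" "is_projection p" "is_projection q" "op_le p q"
  shows "Re (\<psi> p) \<le> Re (\<psi> q)"
proof -
  have "\<psi> (q - p) \<in> \<real>\<^sub>\<ge>\<^sub>0"
    using assms(4) is_stateD(3)[OF assms(1)] by (simp add: op_le_def)
  then show ?thesis
    by (simp add: state_diff[OF assms(1)] complex_nonneg_Reals_iff)
qed

lemma state_projection_le_1:
  assumes "is_state \<psi>" "is_projection p"
  shows "Re (\<psi> p) \<le> 1"
  using state_projection(2)[OF assms(1) is_projection_complement[OF assms(2)]]
  by (simp add: state_diff[OF assms(1)] is_stateD(4)[OF assms(1)])

text \<open>One direction is monotonicity of the state. The other is the inequality
  \<open>\<psi> p + \<psi> q \<le> 1 + \<psi> (p ** q)\<close>, read on real parts.\<close>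

lemma state_mult_eq_1_iff:
  assumes \<psi>: "is_state \<psi>" and C: "C \<in> contexts" and p: "p \<in> Proj C" and q: "q \<in> Proj C"
  shows "\<psi> (p ** q) = 1 \<longleftrightarrow> \<psi> p = 1 \<and> \<psi> q = 1"
proof -
  have pq: "p ** q = q ** p" using contextD(6)[OF C] p q by (simp add: ProjD)
  note Pr = ProjD(2)[OF p] ProjD(2)[OF q] ProjD(2)[OF Proj_mult[OF C p q]]
  have eq_1: "\<psi> r = 1 \<longleftrightarrow> 1 \<le> Re (\<psi> r)" if "is_projection r" for r
    using state_projection(1)[OF \<psi> that] state_projection_le_1[OF \<psi> that]
    by (metis antisym of_real_1 one_complex.simps(1) order_refl)
  have "op_le (p ** q) p" "op_le (p ** q) q"
    using Pr by (simp_all add: projection_op_le_iff matrix_mul_assoc is_projectionD)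
      (metis is_projectionD(2) matrix_mul_assoc pq)
  then have le: "Re (\<psi> (p ** q)) \<le> Re (\<psi> p)" "Re (\<psi> (p ** q)) \<le> Re (\<psi> q)"
    using Pr state_projection_mono[OF \<psi>] by blast+
  \<comment> \<open>The part of \<open>p\<close> outside \<open>q\<close>. It lies below the
    complement of \<open>q\<close>, which bounds \<open>\<psi> p - \<psi> (p ** q)\<close> by
    \<open>1 - \<psi> q\<close>.\<close>
  let ?r = "p ** (mat 1 - q)"
  have r: "?r \<in> Proj C"
    by (rule Proj_mult[OF C p Proj_complement[OF C q]])
  have "op_le ?r (mat 1 - q)"
    using Pr(2) ProjD(2)[OF r] pq
    by (simp add: projection_op_le_iff is_projection_complement)
      (simp add: matrix_diff_ldistrib matrix_diff_rdistrib matrix_mul_assoc,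
       metis is_projectionD(2) matrix_mul_assoc diff_self)
  then have "Re (\<psi> ?r) \<le> Re (\<psi> (mat 1 - q))"
    by (intro state_projection_mono[OF \<psi> ProjD(2)[OF r] is_projection_complement[OF Pr(2)]])
  then have "Re (\<psi> p) + Re (\<psi> q) \<le> 1 + Re (\<psi> (p ** q))"
    by (simp add: matrix_diff_ldistrib state_diff[OF \<psi>] is_stateD(4)[OF \<psi>])
  then show ?thesis
    using le Pr by (auto simp: eq_1)
qed

section \<open>The Riesz-Markov measure on the finite discrete spectrum\<close>

lemma openin_gelfand_topology:
  assumes C: "C \<in> contexts"
  shows "openin (gelfand_topology C) U \<longleftrightarrow> U \<subseteq> gelfand C"
proof
  assume "openin (gelfand_topology C) U"
  then show "U \<subseteq> gelfand C"
    by (metis openin_subset topspace_gelfand_topology)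
next
  assume U: "U \<subseteq> gelfand C"
  \<comment> \<open>\<open>l\<close> is the only character with value one at its own projection, so
    its singleton is the clopen set of a projection.\<close>
  have "openin (gelfand_topology C) {l}" if l: "l \<in> gelfand C" for l
  proof -
    have "{l' \<in> gelfand C. l' (character_projection C l) = 1} = {l}"
      using l by (auto simp: character_character_projection[OF C] split: if_splits)
    then show ?thesis
      using openin_gelfand_projection[of "character_projection C l" C]
      by (simp add: Proj_def character_projection_in_context[OF C] is_projection_character_projection)
  qed
  then have "openin (gelfand_topology C) (\<Union>l\<in>U. {l})"
    using U by (intro openin_Union) auto
  then show "openin (gelfand_topology C) U" by simp
qed

text \<open>On a discrete spectrum all subsets are Borel, and outer regularity is automatic because
  each set is open and hence attains its own infimum.\<close>

lemma represents_iff: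
  assumes C: "C \<in> contexts"
  shows "represents \<psi> C M \<longleftrightarrow> prob_space M \<and> space M = gelfand C \<and> sets M = Pow (gelfand C) \<and>
    (\<forall>x\<in>C. integrable M (\<lambda>l. l x) \<and> integral\<^sup>L M (\<lambda>l. l x) = \<psi> x)"
proof -
  have opens: "{U. openin (gelfand_topology C) U} = Pow (gelfand C)"
    by (auto simp: openin_gelfand_topology[OF C])
  have sigma: "sigma_sets (gelfand C) (Pow (gelfand C)) = Pow (gelfand C)"
    by (metis sigma_algebra.sigma_sets_eq sigma_algebra_Pow)
  have regular: "measure M B = (INF U\<in>{U. openin (gelfand_topology C) U \<and> B \<subseteq> U}. measure M U)"
    if M: "prob_space M" "sets M = Pow (gelfand C)" and B: "B \<in> sets M" for B
  proof (rule cInf_eq_minimum[symmetric])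
    interpret prob_space M by fact
    show "measure M B \<in> measure M ` {U. openin (gelfand_topology C) U \<and> B \<subseteq> U}"
      using B M(2) by (auto simp: openin_gelfand_topology[OF C])
    show "measure M B \<le> x" if "x \<in> measure M ` {U. openin (gelfand_topology C) U \<and> B \<subseteq> U}" for x
      using that M(2) by (auto simp: openin_gelfand_topology[OF C] intro: finite_measure_mono)
  qed
  show ?thesis
    unfolding represents_def opens sigma
    by (intro iffI conjI; elim conjE) (assumption | rule ballI regular)+
qed

text \<open>On the spectrum the function \<open>\<lambda>l. l p\<close> takes only the values 0 and
  1, so it is the indicator of the clopen set, and its integral is the measure.\<close>

lemma measure_represents:
  assumes C: "C \<in> contexts" and M: "represents \<psi> C M" and p: "p \<in> Proj C"
  shows "complex_of_real (measure M {l \<in> gelfand C. l p = 1}) = \<psi> p"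
proof -
  let ?U = "{l \<in> gelfand C. l p = 1}"
  note M' = M[unfolded represents_iff[OF C]]
  interpret prob_space M using M' by blast
  have "\<psi> p = integral\<^sup>L M (\<lambda>l. l p)"
    using M' ProjD(1)[OF p] by simp
  also have "\<dots> = integral\<^sup>L M (\<lambda>l. complex_of_real (indicator ?U l))"
    using M' gelfand_projection_values[OF _ p]
    by (intro Bochner_Integration.integral_cong) (auto simp: indicator_def)
  also have "\<dots> = complex_of_real (measure M (?U \<inter> space M))"
    by (subst integral_complex_of_real) simp
  also have "?U \<inter> space M = ?U" using M' by auto
  finally show ?thesis by simp
qed

text \<open>A finite measure on a finite set is determined by its point masses, and the mass of
  \<open>l\<close> must be the value of the state at the projection of \<open>l\<close>.\<close>

lemma represents_unique:
  assumes C: "C \<in> contexts" and M: "represents \<psi> C M" and N: "represents \<psi> C N"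
  shows "M = N"
proof (rule measure_eqI_finite)
  note M' = M[unfolded represents_iff[OF C]] and N' = N[unfolded represents_iff[OF C]]
  interpret M: prob_space M using M' by blast
  interpret N: prob_space N using N' by blast
  show "sets M = Pow (gelfand C)" "sets N = Pow (gelfand C)" by (simp_all only: M' N')
  show "finite (gelfand C)" by (rule finite_gelfand[OF C])
  fix l assume l: "l \<in> gelfand C"
  let ?q = "character_projection C l"
  have q: "?q \<in> Proj C"
    by (simp add: Proj_def character_projection_in_context[OF C] is_projection_character_projection)
  have singleton: "{l' \<in> gelfand C. l' ?q = 1} = {l}"
    using l by (auto simp: character_character_projection[OF C] split: if_splits)
  have "complex_of_real (measure M {l}) = \<psi> ?q"
    using measure_represents[OF C M q] unfolding singleton .
  moreover have "complex_of_real (measure N {l}) = \<psi> ?q"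
    using measure_represents[OF C N q] unfolding singleton .
  ultimately have "measure M {l} = measure N {l}"
    by (metis of_real_eq_iff)
  then show "emeasure M {l} = emeasure N {l}"
    by (simp add: M.emeasure_eq_measure N.emeasure_eq_measure)
qed

text \<open>Give \<open>l\<close> the mass \<open>w l\<close>. The total is one because the
  projections sum to the unit, and integrating \<open>\<lambda>l. l x\<close> gives the state
  applied to the spectral decomposition of \<open>x\<close>.\<close>

lemma represents_exists:
  assumes \<psi>: "is_state \<psi>" and C: "C \<in> contexts"
  shows "\<exists>M. represents \<psi> C M"
proof -
  define w where "w l = Re (\<psi> (character_projection C l))" for l
  define M where "M = point_measure (gelfand C) (\<lambda>l. ennreal (w l))"
  note fin = finite_gelfand[OF C]
  have w: "\<psi> (character_projection C l) = complex_of_real (w l)" "0 \<le> w l" for l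
    unfolding w_def using state_projection[OF \<psi> is_projection_character_projection] by blast+
  have "complex_of_real (\<Sum>l\<in>gelfand C. w l) = \<psi> (\<Sum>l\<in>gelfand C. character_projection C l)"
    by (simp add: state_sum[OF \<psi>] w(1))
  then have "(\<Sum>l\<in>gelfand C. w l) = 1"
    by (simp only: sum_character_projection[OF C] is_stateD(4)[OF \<psi>] of_real_eq_1_iff)
  then have "emeasure M (space M) = 1"
    by (simp add: M_def space_point_measure emeasure_point_measure_finite fin sum_ennreal w(2))
  then have "prob_space M" by (rule prob_spaceI)
  moreover have "integral\<^sup>L M (\<lambda>l. l x) = \<psi> x" if "x \<in> C" for x
  proof -
    have "\<psi> x = \<psi> (\<Sum>l\<in>gelfand C. mat (l x) ** character_projection C l)"
      using context_spectral_decomposition[OF C that] by simp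
    also have "\<dots> = (\<Sum>l\<in>gelfand C. l x * complex_of_real (w l))"
      by (simp add: state_sum[OF \<psi>] is_stateD(2)[OF \<psi>] w(1))
    also have "\<dots> = integral\<^sup>L M (\<lambda>l. l x)"
      by (simp add: M_def lebesgue_integral_point_measure_finite fin w(2) scaleR_conv_of_real mult.commute)
    finally show ?thesis by simp
  qed
  ultimately have "represents \<psi> C M"
    unfolding represents_iff[OF C]
    by (simp add: M_def space_point_measure sets_point_measure integrable_point_measure_finite fin)
  then show ?thesis ..
qed

lemma measure_riesz_markov:
  assumes "is_state \<psi>" "C \<in> contexts" "p \<in> Proj C"
  shows "complex_of_real (measure (riesz_markov \<psi> C) {l \<in> gelfand C. l p = 1}) = \<psi> p"
proof -
  have "\<exists>!M. represents \<psi> C M"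
    using represents_exists[OF assms(1,2)] represents_unique[OF assms(2)] by blast
  then have "represents \<psi> C (riesz_markov \<psi> C)"
    unfolding riesz_markov_def by (rule theI')
  then show ?thesis by (rule measure_represents[OF assms(2) _ assms(3)])
qed

section \<open>The valuation of the meet and the equivalence\<close>

lemma state_val_elem_prop_meet:
  assumes \<psi>: "is_state \<psi>" and a: "selfadjoint a1" "selfadjoint a2" and D: "D \<in> contexts"
  shows "complex_of_real (state_val \<psi> (elem_prop a1 \<Delta>1 \<sqinter>\<^bsub>Sigma_frame\<^esub> elem_prop a2 \<Delta>2) D)
    = \<psi> (outer_das (spectral_projection \<Delta>1 a1) D ** outer_das (spectral_projection \<Delta>2 a2) D)"
proof -
  let ?d1 = "outer_das (spectral_projection \<Delta>1 a1) D"
  let ?d2 = "outer_das (spectral_projection \<Delta>2 a2) D"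
  have d: "?d1 \<in> Proj D" "?d2 \<in> Proj D"
    using a by (auto intro: outer_das_Proj[OF D is_projection_spectral_projection])
  have "(elem_prop a1 \<Delta>1 \<sqinter>\<^bsub>Sigma_frame\<^esub> elem_prop a2 \<Delta>2) `` {D}
      = {l \<in> gelfand D. l ?d1 = 1 \<and> l ?d2 = 1}"
    unfolding Sigma_frame_meet[OF Sigma_open_elem_prop[OF a(1)] Sigma_open_elem_prop[OF a(2)]]
    using D by (auto simp: elem_prop_def)
  \<comment> \<open>Both values are 0 or 1, so both are one exactly when their product is.\<close>
  also have "\<dots> = {l \<in> gelfand D. l (?d1 ** ?d2) = 1}"
  proof -
    have "l ?d1 = 1 \<and> l ?d2 = 1 \<longleftrightarrow> l (?d1 ** ?d2) = 1" if "l \<in> gelfand D" for l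
      using gelfand_projection_values[OF that d(1)] gelfand_projection_values[OF that d(2)]
        gelfandD(3)[OF that ProjD(1)[OF d(1)] ProjD(1)[OF d(2)]] by auto
    then show ?thesis by blast
  qed
  finally show ?thesis
    unfolding state_val_def using measure_riesz_markov[OF \<psi> D Proj_mult[OF D d]] by simp
qed

theorem proposition4p3:
  fixes \<psi> :: "'n::finite cmat \<Rightarrow> complex"
    and a1 a2 :: "'n cmat"
    and \<Delta>1 \<Delta>2 :: "real set"
    and C :: "'n cmat set"
  assumes "is_state \<psi>"
    and "selfadjoint a1" and "selfadjoint a2"
    and "open \<Delta>1" and "open \<Delta>2"
    and "C \<in> contexts"
  shows "forces_val_one C \<psi> (elem_prop a1 \<Delta>1 \<sqinter>\<^bsub>Sigma_frame\<^esub> elem_prop a2 \<Delta>2) \<longleftrightarrow>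
    (\<forall>p\<in>Proj C.
       op_le (spectral_projection \<Delta>1 a1) p \<or> op_le (spectral_projection \<Delta>2 a2) p
         \<longrightarrow> \<psi> p = 1)"
proof -
  note \<psi> = assms(1) and C = assms(6)
  let ?p1 = "spectral_projection \<Delta>1 a1" and ?p2 = "spectral_projection \<Delta>2 a2"
  have p: "is_projection ?p1" "is_projection ?p2"
    using assms(2,3) by (simp_all add: is_projection_spectral_projection)
  \<comment> \<open>At each stage the valuation of the meet is the value of the state at a product
    of two projections, which is one exactly when both factors have value one.\<close>
  have forces: "forces_val_one C \<psi> (elem_prop a1 \<Delta>1 \<sqinter>\<^bsub>Sigma_frame\<^esub> elem_prop a2 \<Delta>2) \<longleftrightarrow>
      (\<forall>D\<in>contexts. D \<subseteq> C \<longrightarrow> \<psi> (outer_das ?p1 D) = 1 \<and> \<psi> (outer_das ?p2 D) = 1)"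
  proof -
    have "state_val \<psi> (elem_prop a1 \<Delta>1 \<sqinter>\<^bsub>Sigma_frame\<^esub> elem_prop a2 \<Delta>2) D = 1 \<longleftrightarrow>
        \<psi> (outer_das ?p1 D) = 1 \<and> \<psi> (outer_das ?p2 D) = 1" if D: "D \<in> contexts" for D
      using state_val_elem_prop_meet[OF \<psi> assms(2,3) D, of \<Delta>1 \<Delta>2]
        state_mult_eq_1_iff[OF \<psi> D outer_das_Proj[OF D p(1)] outer_das_Proj[OF D p(2)]]
      by (metis of_real_eq_1_iff)
    then show ?thesis unfolding forces_val_one_def by blast
  qed
  show ?thesis
    unfolding forces
  proof (intro iffI ballI impI)
    fix r
    assume das: "\<forall>D\<in>contexts. D \<subseteq> C \<longrightarrow> \<psi> (outer_das ?p1 D) = 1 \<and> \<psi> (outer_das ?p2 D) = 1"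
      and r: "r \<in> Proj C" and le: "op_le ?p1 r \<or> op_le ?p2 r"
    \<comment> \<open>The stage \<open>C\<close> decides: \<open>r\<close> lies above the
      daseinisation of \<open>q\<close> at \<open>C\<close>, and monotonicity squeezes its value
      between one and one.\<close>
    have "\<psi> r = 1" if q: "is_projection q" "op_le q r" "\<psi> (outer_das q C) = 1" for q
    proof -
      have "Re (\<psi> (outer_das q C)) \<le> Re (\<psi> r)"
        by (intro state_projection_mono[OF \<psi>] outer_das_least[OF C q(1) r q(2)] ProjD(2)[OF r]
            ProjD(2)[OF outer_das_Proj[OF C q(1)]])
      then have "Re (\<psi> r) = 1"
        using state_projection_le_1[OF \<psi> ProjD(2)[OF r]] q(3) by simp
      then show ?thesis
        using state_projection(1)[OF \<psi> ProjD(2)[OF r]] by simp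
    qed
    then show "\<psi> r = 1" using le p das C by blast
  next
    fix D assume all: "\<forall>p\<in>Proj C. op_le ?p1 p \<or> op_le ?p2 p \<longrightarrow> \<psi> p = 1"
      and D: "D \<in> contexts" "D \<subseteq> C"
    \<comment> \<open>The daseinisation at a smaller context \<open>D\<close> is again a projection
      of \<open>C\<close> above \<open>q\<close>, so the second condition applies to it.\<close>
    have "outer_das q D \<in> Proj C" if "is_projection q" for q
      using outer_das_Proj[OF D(1) that] D(2) by (auto simp: Proj_def)
    then show "\<psi> (outer_das ?p1 D) = 1 \<and> \<psi> (outer_das ?p2 D) = 1"
      using all p op_le_outer_das[OF D(1)] by blast
  qed
qed

end
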